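(* Consider the problem $f_0^*=\min_{x\in Q}\{f_0(x):\ f_i(x)\le0,\ i=1,\dots,m\}$, with an optimal solution $x^*$. Let $\{x_k\}_{k\ge0}$ be generated by the switching subgradient method described in the context with step bounds $h_k=\sqrt{2D}\,\tau_k$, $k\ge0$, where $\tau_k\ge\tau_{k+1}>0$ for all $k\ge0$ and $\sum_{k=0}^\infty\tau_k^2=+\infty$. Let $a(\cdot)$ be the divergence delay of $\{\tau_k\}$, and for $N\ge1+a(0)$ let $k(N)=\max\{k\ge0:\ k+a(k)\le N-1\}$. Then for any $N\ge1+a(0)$ we have $\mathcal{A}_0(N)\ne\emptyset$. Moreover, if $\|f_i'(x)\|_*\le M_i$ for all $x\in Q$ and $i=0,\dots,m$ (with $M_i>0$), then $$\max_{1\le i\le m}\frac{1}{M_i}f_i(x_k)\ \le\ h_{k(N)},\qquad k\in\mathcal{A}_0(N),$$ $$\frac{1}{\sigma_0(N)}\sum_{k\in\mathcal{A}_0(N)}\lambda_kf_0(x_k)\ \le\ \phi(\bar\lambda^*(N))+M_0h_{k(N)}.$$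
   Context: $\mathbb{E}$ is a finite-dimensional real vector space with dual $\mathbb{E}^*$, $\langle s,x\rangle$ is the value of $s\in\mathbb{E}^*$ at $x$, $\|\cdot\|$ is an arbitrary norm on $\mathbb{E}$ and $\|g\|_*=\max\{\langle g,x\rangle:\|x\|\le1\}$. The functions $f_0,\dots,f_m$ are closed, convex and subdifferentiable on $Q$; $Q\subset\mathbb{E}$ is closed, convex and bounded; $f_i'(x)$ is a fixed subgradient of $f_i$ at $x\in Q$. Write $\bar f(x)=(f_1(x),\dots,f_m(x))^T$. Prox-function: $d$ is continuously differentiable on a convex open domain $\mathrm{dom}\,d\supseteq Q$ with $d(y)\ge d(x)+\langle\nabla d(x),y-x\rangle+\frac12\|y-x\|^2$. Bregman distance: $\beta_d(x,y)=d(y)-d(x)-\langle\nabla d(x),y-x\rangle$. The constant $D$ satisfies $\beta_d(x,y)<D$ for all $x,y\in Q$. Dual function: $\phi(\bar\lambda)=\min_{x\in Q}\{f_0(x)+\langle\bar\lambda,\bar f(x)\rangle\}$, $\bar\lambda\in\mathbb{R}^m_+$. Objective step: $\varphi_{0,x}(\lambda)=\max_{T\in Q}\{\lambda\langle f_0'(x),x-T\rangle-\beta_d(x,T)\}$ for $x\in Q$, $\lambda\ge0$, with maximizer $T_{0,x}(\lambda)$. Constraint step: for $1\le i\le m$, $$\hat T_i(x_k)=\arg\min_{T\in Q}\{\beta_d(x_k,T):\ f_i(x_k)+\langle f_i'(x_k),T-x_k\rangle\le0\},$$ and $\lambda_i(x_k)\ge0$ is the optimal Lagrange multiplier for the linear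 inequality constraint of this problem: with $T=\hat T_i(x_k)$, $\langle\nabla d(T)-\nabla d(x_k)+\lambda_i(x_k)f_i'(x_k),x-T\rangle\ge0$ for all $x\in Q$, and $\lambda_i(x_k)\,[f_i(x_k)+\langle f_i'(x_k),T-x_k\rangle]=0$. Method: choose $x_0\in Q$ and positive $\{h_k\}_{k\ge0}$. For $k\ge0$: (1) compute $r_k^i=\beta_d(x_k,\hat T_i(x_k))$, $1\le i\le m$. (2) If there is $i\in\{1,\dots,m\}$ with $r_k^i\ge\frac12h_k^2$, pick such an $i$ and set $i_k=i$, $\lambda_k=\lambda_i(x_k)$, $x_{k+1}=\hat T_i(x_k)$. (3) Otherwise set $i_k=0$, find $\lambda_k>0$ with $\varphi_{0,x_k}(\lambda_k)=\frac12h_k^2$, and set $x_{k+1}=T_{0,x_k}(\lambda_k)$. The multipliers $\lambda_i(x_k)$ and the solutions of the equation in (3) are assumed to exist whenever needed. Divergence delay: $a(k)\ge0$ is the minimal nonnegative integer such that $\sum_{i=k}^{k+a(k)}\tau_i^2\ge1$. Further notation: $\mathcal{A}_i(N)=\{k:\ k(N)\le k\le N-1,\ i_k=i\}$ and $\sigma_i(N)=\sum_{k\in\mathcal{A}_i(N)}\lambda_k$ for $i=0,\dots,m$ (empty sums are zero); $\lambda_i^*(N)=\sigma_i(N)/\sigma_0(N)$ for $i=1,\dots,m$, and $\bar\lambda^*(N)=(\lambda_1^*(N),\dots,\lambda_m^*(N))$, defined when $\mathcal{A}_0(N)\ne\emptyset$. *)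

theory Defs
  imports "HOL-Analysis.Analysis"
begin

text \<open>
  The dual space of \<open>'a\<close> is \<open>'a \<Rightarrow>\<^sub>L real\<close>, and \<open>\<langle>g, x\<rangle>\<close> is \<open>blinfun_apply g x\<close>. The dual norm is
  the library norm (operator norm) on this type; it is the supremum of \<open>\<langle>g, x\<rangle>\<close> over the unit ball.
\<close>

lemma norm_blinfun_eq_SUP_cball:
  fixes g :: "'a::real_normed_vector \<Rightarrow>\<^sub>L real"
  shows "norm g = (SUP x\<in>cball 0 1. blinfun_apply g x)"
proof (rule antisym)
  have le: "blinfun_apply g x \<le> norm g" if "norm x \<le> 1" for x
  proof -
    have "blinfun_apply g x \<le> norm (blinfun_apply g x)" by simp
    also have "\<dots> \<le> norm g * norm x" by (rule norm_blinfun)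
    also have "\<dots> \<le> norm g" using that by (simp add: mult_left_le)
    finally show ?thesis .
  qed
  have bdd: "bdd_above (blinfun_apply g ` cball 0 1)"
    using le by (auto intro!: bdd_aboveI2)
  show "(SUP x\<in>cball 0 1. blinfun_apply g x) \<le> norm g"
    by (rule cSUP_least) (auto intro: le)
  have up: "blinfun_apply g x \<le> (SUP x\<in>cball 0 1. blinfun_apply g x)" if "norm x \<le> 1" for x
    using that by (intro cSUP_upper[OF _ bdd]) auto
  have nonneg: "0 \<le> (SUP x\<in>cball 0 1. blinfun_apply g x)"
    using up[of 0] by (simp add: blinfun.zero_right)
  show "norm g \<le> (SUP x\<in>cball 0 1. blinfun_apply g x)"
  proof (rule norm_blinfun_bound[OF nonneg])
    fix x
    show "norm (blinfun_apply g x) \<le> (SUP x\<in>cball 0 1. blinfun_apply g x) * norm x"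
    proof (cases "x = 0")
      case False
      have "\<bar>blinfun_apply g x\<bar> / norm x \<le> (SUP x\<in>cball 0 1. blinfun_apply g x)"
        using up[of "x /\<^sub>R norm x"] up[of "- (x /\<^sub>R norm x)"] False
        by (simp add: blinfun.scaleR_right blinfun.minus_right field_simps abs_if)
      then show ?thesis using False by (simp add: field_simps)
    qed (simp add: blinfun.zero_right)
  qed
qed

definition finite_dimensional :: "'a::real_vector itself \<Rightarrow> bool" where
  "finite_dimensional _ \<longleftrightarrow> (\<exists>B::'a set. finite B \<and> span B = UNIV)"

text \<open>
  Only the values of a function on \<open>Q\<close> matter, so closedness and the subgradient inequality are
  taken relative to \<open>Q\<close>. For a closed convex function on a larger domain these follow from their
  unrestricted versions, because \<open>Q\<close> is closed.
\<close>

definition closed_convex_on :: "'a::real_normed_vector set \<Rightarrow> ('a \<Rightarrow> real) \<Rightarrow> bool" where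
  "closed_convex_on Q f \<longleftrightarrow> convex_on Q f \<and> closed (epigraph Q f)"

definition is_subgradient ::
  "'a::real_normed_vector set \<Rightarrow> ('a \<Rightarrow> real) \<Rightarrow> 'a \<Rightarrow> ('a \<Rightarrow>\<^sub>L real) \<Rightarrow> bool" where
  "is_subgradient Q f x g \<longleftrightarrow> (\<forall>y\<in>Q. f y \<ge> f x + blinfun_apply g (y - x))"

text \<open>\<open>S\<close> is the domain of \<open>d\<close> and \<open>d'\<close> its gradient.\<close>

definition prox_function ::
  "'a::real_normed_vector set \<Rightarrow> 'a set \<Rightarrow> ('a \<Rightarrow> real) \<Rightarrow> ('a \<Rightarrow> 'a \<Rightarrow>\<^sub>L real) \<Rightarrow> bool" where
  "prox_function Q S d d' \<longleftrightarrow>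
     open S \<and> convex S \<and> Q \<subseteq> S \<and>
     (\<forall>x\<in>S. (d has_derivative blinfun_apply (d' x)) (at x)) \<and>
     continuous_on S d' \<and>
     (\<forall>x\<in>S. \<forall>y\<in>S. d y \<ge> d x + blinfun_apply (d' x) (y - x) + (1/2) * (norm (y - x))\<^sup>2)"

definition bregman ::
  "('a::real_normed_vector \<Rightarrow> real) \<Rightarrow> ('a \<Rightarrow> 'a \<Rightarrow>\<^sub>L real) \<Rightarrow> 'a \<Rightarrow> 'a \<Rightarrow> real" where
  "bregman d d' x y = d y - d x - blinfun_apply (d' x) (y - x)"

text \<open>
  The objective is \<open>f 0\<close>, the constraints are \<open>f 1, \<dots>, f m\<close>, and a vector of \<open>m\<close> multipliers is a
  function whose values at \<open>1, \<dots>, m\<close> are its components. The infimum below is attained when \<open>Q\<close> is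
  compact, all \<open>f i\<close> are lower semicontinuous on \<open>Q\<close>, and the multipliers are nonnegative.
\<close>

definition feasible :: "'a set \<Rightarrow> nat \<Rightarrow> (nat \<Rightarrow> 'a \<Rightarrow> real) \<Rightarrow> 'a \<Rightarrow> bool" where
  "feasible Q m f x \<longleftrightarrow> x \<in> Q \<and> (\<forall>i\<in>{1..m}. f i x \<le> 0)"

definition dual_function ::
  "'a set \<Rightarrow> nat \<Rightarrow> (nat \<Rightarrow> 'a \<Rightarrow> real) \<Rightarrow> (nat \<Rightarrow> real) \<Rightarrow> real" where
  "dual_function Q m f l = (INF x\<in>Q. f 0 x + (\<Sum>i=1..m. l i * f i x))"

text \<open>In the next four definitions \<open>g\<close> is the subgradient, at the current point \<open>x\<close>, of the function
  used in the step; for constraint steps, \<open>c\<close> is the value of that function at \<open>x\<close>.\<close>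

definition objective_gain ::
  "'a::real_normed_vector set \<Rightarrow> ('a \<Rightarrow> real) \<Rightarrow> ('a \<Rightarrow> 'a \<Rightarrow>\<^sub>L real) \<Rightarrow> ('a \<Rightarrow>\<^sub>L real)
     \<Rightarrow> 'a \<Rightarrow> real \<Rightarrow> real" where
  "objective_gain Q d d' g x l = (SUP T\<in>Q. l * blinfun_apply g (x - T) - bregman d d' x T)"

definition is_objective_step ::
  "'a::real_normed_vector set \<Rightarrow> ('a \<Rightarrow> real) \<Rightarrow> ('a \<Rightarrow> 'a \<Rightarrow>\<^sub>L real) \<Rightarrow> ('a \<Rightarrow>\<^sub>L real)
     \<Rightarrow> 'a \<Rightarrow> real \<Rightarrow> 'a \<Rightarrow> bool" where
  "is_objective_step Q d d' g x l T \<longleftrightarrow>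
     is_arg_max (\<lambda>T. l * blinfun_apply g (x - T) - bregman d d' x T) (\<lambda>T. T \<in> Q) T"

definition is_constraint_step ::
  "'a::real_normed_vector set \<Rightarrow> ('a \<Rightarrow> real) \<Rightarrow> ('a \<Rightarrow> 'a \<Rightarrow>\<^sub>L real) \<Rightarrow> real \<Rightarrow> ('a \<Rightarrow>\<^sub>L real)
     \<Rightarrow> 'a \<Rightarrow> 'a \<Rightarrow> bool" where
  "is_constraint_step Q d d' c g x T \<longleftrightarrow>
     is_arg_min (bregman d d' x) (\<lambda>T. T \<in> Q \<and> c + blinfun_apply g (T - x) \<le> 0) T"

definition is_constraint_multiplier ::
  "'a::real_normed_vector set \<Rightarrow> ('a \<Rightarrow> 'a \<Rightarrow>\<^sub>L real) \<Rightarrow> real \<Rightarrow> ('a \<Rightarrow>\<^sub>L real)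
     \<Rightarrow> 'a \<Rightarrow> 'a \<Rightarrow> real \<Rightarrow> bool" where
  "is_constraint_multiplier Q d' c g x T l \<longleftrightarrow>
     l \<ge> 0 \<and>
     (\<forall>y\<in>Q. blinfun_apply (d' T - d' x + l *\<^sub>R g) (y - T) \<ge> 0) \<and>
     l * (c + blinfun_apply g (T - x)) = 0"

text \<open>
  A run of the switching subgradient scheme with step bounds \<open>h\<close>: \<open>x\<close> is the sequence of iterates,
  \<open>T k i\<close> the minimizer for the \<open>i\<close>-th constraint at \<open>x k\<close>, \<open>j k\<close> the index chosen at iteration \<open>k\<close>
  (0 for an objective step), and \<open>l k\<close> the multiplier of iteration \<open>k\<close>.
\<close>

definition switching_run ::
  "'a::real_normed_vector set \<Rightarrow> nat \<Rightarrow> (nat \<Rightarrow> 'a \<Rightarrow> real) \<Rightarrow> (nat \<Rightarrow> 'a \<Rightarrow> 'a \<Rightarrow>\<^sub>L real)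
     \<Rightarrow> ('a \<Rightarrow> real) \<Rightarrow> ('a \<Rightarrow> 'a \<Rightarrow>\<^sub>L real) \<Rightarrow> (nat \<Rightarrow> real)
     \<Rightarrow> (nat \<Rightarrow> 'a) \<Rightarrow> (nat \<Rightarrow> nat \<Rightarrow> 'a) \<Rightarrow> (nat \<Rightarrow> nat) \<Rightarrow> (nat \<Rightarrow> real) \<Rightarrow> bool" where
  "switching_run Q m f f' d d' h x T j l \<longleftrightarrow>
     x 0 \<in> Q \<and> (\<forall>k. h k > 0) \<and>
     (\<forall>k. (\<forall>i\<in>{1..m}. is_constraint_step Q d d' (f i (x k)) (f' i (x k)) (x k) (T k i)) \<and>
       (if \<exists>i\<in>{1..m}. bregman d d' (x k) (T k i) \<ge> (1/2) * (h k)\<^sup>2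
        then j k \<in> {1..m} \<and>
             bregman d d' (x k) (T k (j k)) \<ge> (1/2) * (h k)\<^sup>2 \<and>
             is_constraint_multiplier Q d' (f (j k) (x k)) (f' (j k) (x k)) (x k) (T k (j k)) (l k) \<and>
             x (Suc k) = T k (j k)
        else j k = 0 \<and>
             l k > 0 \<and>
             objective_gain Q d d' (f' 0 (x k)) (x k) (l k) = (1/2) * (h k)\<^sup>2 \<and>
             is_objective_step Q d d' (f' 0 (x k)) (x k) (l k) (x (Suc k))))"

definition divergence_delay :: "(nat \<Rightarrow> real) \<Rightarrow> nat \<Rightarrow> nat" where
  "divergence_delay \<tau> k = (LEAST a. (\<Sum>i=k..k+a. (\<tau> i)\<^sup>2) \<ge> 1)"

definition start_index :: "(nat \<Rightarrow> real) \<Rightarrow> nat \<Rightarrow> nat" where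
  "start_index \<tau> N = Max {k. k + divergence_delay \<tau> k \<le> N - 1}"

definition steps_with :: "(nat \<Rightarrow> real) \<Rightarrow> (nat \<Rightarrow> nat) \<Rightarrow> nat \<Rightarrow> nat \<Rightarrow> nat set" where
  "steps_with \<tau> j i N = {k. start_index \<tau> N \<le> k \<and> k \<le> N - 1 \<and> j k = i}"

definition multiplier_sum ::
  "(nat \<Rightarrow> real) \<Rightarrow> (nat \<Rightarrow> nat) \<Rightarrow> (nat \<Rightarrow> real) \<Rightarrow> nat \<Rightarrow> nat \<Rightarrow> real" where
  "multiplier_sum \<tau> j l i N = (\<Sum>k\<in>steps_with \<tau> j i N. l k)"

definition dual_estimate ::
  "(nat \<Rightarrow> real) \<Rightarrow> (nat \<Rightarrow> nat) \<Rightarrow> (nat \<Rightarrow> real) \<Rightarrow> nat \<Rightarrow> nat \<Rightarrow> real" where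
  "dual_estimate \<tau> j l N i = multiplier_sum \<tau> j l i N / multiplier_sum \<tau> j l 0 N"

end

theory Submission
  imports Defs
begin

text \<open>
  The distance \<open>\<beta>(x\<^sub>k, y)\<close> to a fixed \<open>y \<in> Q\<close> is a potential. An objective step raises it by at most
  \<open>h\<^sub>k\<^sup>2/2 - \<lambda>\<^sub>k (f\<^sub>0(x\<^sub>k) - f\<^sub>0(y))\<close>, whereas a constraint step with index \<open>i\<close> raises it by at most
  \<open>\<lambda>\<^sub>k f\<^sub>i(y) - h\<^sub>k\<^sup>2/2\<close>. By the choice of \<open>k(N)\<close>, the sum of \<open>h\<^sub>k\<^sup>2/2 = D \<tau>\<^sub>k\<^sup>2\<close> over \<open>k(N) \<le> k < N\<close> is at
  least \<open>D\<close>, which exceeds any initial potential. So constraint steps alone would make the potential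
  at a feasible \<open>y\<close> negative, and in general the summed inequalities leave an error of
  at most the sum of \<open>h\<^sub>k\<^sup>2\<close> over the objective steps. Since the gain of an objective step is
  at most \<open>\<lambda>\<^sub>k\<^sup>2 M\<^sub>0\<^sup>2/2\<close>, we have \<open>h\<^sub>k \<le> \<lambda>\<^sub>k M\<^sub>0\<close>, and the error is at most \<open>\<sigma>\<^sub>0 M\<^sub>0 h\<close> with \<open>h\<close>
  taken at the index \<open>k(N)\<close>.
\<close>

section \<open>Bregman distances and the estimates for a single step\<close>

lemma bregman_three_points:
  "bregman d d' z y = bregman d d' x y - bregman d d' x z + blinfun_apply (d' x - d' z) (y - z)"
  by (simp add: bregman_def blinfun.diff_left blinfun.diff_right)

lemma bregman_ge_half_norm_sq:
  assumes "prox_function Q S d d'" "x \<in> Q" "y \<in> Q"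
  shows "(norm (y - x))\<^sup>2 / 2 \<le> bregman d d' x y"
proof -
  have "d y \<ge> d x + blinfun_apply (d' x) (y - x) + (1/2) * (norm (y - x))\<^sup>2"
    using assms unfolding prox_function_def by blast
  then show ?thesis by (simp add: bregman_def)
qed

text \<open>Both kinds of step satisfy this variational inequality at their new point
  \<open>z\<close>, so they share one estimate: it bounds the last term of the three-point
  identity.\<close>

lemma bregman_step_le:
  assumes "blinfun_apply (d' z - d' x + l *\<^sub>R g) (y - z) \<ge> 0"
  shows "bregman d d' z y \<le> bregman d d' x y - bregman d d' x z + l * blinfun_apply g (y - z)"
  using assms bregman_three_points[of d d' z y x]
  by (simp add: blinfun.add_left blinfun.diff_left blinfun.scaleR_left)

text \<open>Complementary slackness makes \<open>l\<close> times the linearization of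
  \<open>F\<close> vanish at \<open>z\<close>, so \<open>l * blinfun_apply g (y - z)\<close> equals
  \<open>l\<close> times the linearization at \<open>y\<close>, which the subgradient inequality
  bounds by \<open>l * F y\<close>.\<close>

lemma constraint_step_descent:
  assumes "is_constraint_multiplier Q d' (F x) g x z l"
    and "is_subgradient Q F x g" and "y \<in> Q"
  shows "bregman d d' z y \<le> bregman d d' x y - bregman d d' x z + l * F y"
proof -
  have l: "l \<ge> 0" and opt: "blinfun_apply (d' z - d' x + l *\<^sub>R g) (y - z) \<ge> 0"
    and slack: "l * (F x + blinfun_apply g (z - x)) = 0"
    using assms(1,3) by (auto simp: is_constraint_multiplier_def)
  have "l * (F x + blinfun_apply g (y - x)) \<le> l * F y"
    using assms(2,3) l by (intro mult_left_mono) (auto simp: is_subgradient_def)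
  moreover have "l * blinfun_apply g (y - z)
      = l * (F x + blinfun_apply g (y - x)) - l * (F x + blinfun_apply g (z - x))"
    by (simp add: blinfun.diff_right algebra_simps)
  ultimately show ?thesis
    using bregman_step_le[OF opt, of d] slack by linarith
qed

text \<open>First-order condition for a maximum over a convex set: on the segment from
  \<open>z\<close> to \<open>y\<close> the maximized function has at \<open>z\<close> the derivative
  opposite to this pairing, and a positive derivative contradicts maximality.\<close>

lemma objective_step_optimality:
  assumes "is_objective_step Q d d' g x l z"
    and "prox_function Q S d d'" and "convex Q" and "y \<in> Q"
  shows "blinfun_apply (d' z - d' x + l *\<^sub>R g) (y - z) \<ge> 0"
proof (rule ccontr)
  define \<psi> where "\<psi> T = l * blinfun_apply g (x - T) - bregman d d' x T" for T
  assume neg: "\<not> ?thesis"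
  have z: "z \<in> Q" and max: "\<And>T. T \<in> Q \<Longrightarrow> \<psi> T \<le> \<psi> z"
    using assms(1)
    by (auto simp: is_objective_step_def is_arg_max_def \<psi>_def not_less)
  have "z \<in> S" using z assms(2) by (auto simp: prox_function_def)
  then have dz: "(d has_derivative blinfun_apply (d' z)) (at z)"
    using assms(2) by (auto simp: prox_function_def)
  have line: "((\<lambda>t. z + t *\<^sub>R (y - z)) has_derivative (\<lambda>t. t *\<^sub>R (y - z))) (at (0::real))"
    by (auto intro!: derivative_eq_intros)
  have "((\<lambda>t. d (z + t *\<^sub>R (y - z))) has_derivative (\<lambda>t. blinfun_apply (d' z) (t *\<^sub>R (y - z)))) (at 0)"
    using has_derivative_compose[OF line, of d] dz by simp
  then have d_line: "((\<lambda>t. d (z + t *\<^sub>R (y - z))) has_real_derivative blinfun_apply (d' z) (y - z)) (at 0)"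
    by (simp add: has_field_derivative_def blinfun.scaleR_right mult_commute_abs)
  \<comment> \<open>This is \<open>\<psi>\<close> along the segment with all pairings expanded, so
    that everything except \<open>d\<close> is affine in \<open>t\<close>.\<close>
  have "((\<lambda>t. l * (blinfun_apply g (x - z) - t * blinfun_apply g (y - z))
        - (d (z + t *\<^sub>R (y - z)) - d x
           - (blinfun_apply (d' x) (z - x) + t * blinfun_apply (d' x) (y - z))))
      has_real_derivative - blinfun_apply (d' z - d' x + l *\<^sub>R g) (y - z)) (at 0)"
    by (rule derivative_eq_intros d_line refl)+
      (simp add: blinfun.add_left blinfun.diff_left blinfun.scaleR_left algebra_simps)
  moreover have "(\<lambda>t. l * (blinfun_apply g (x - z) - t * blinfun_apply g (y - z))
        - (d (z + t *\<^sub>R (y - z)) - d x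
           - (blinfun_apply (d' x) (z - x) + t * blinfun_apply (d' x) (y - z))))
      = (\<lambda>t. \<psi> (z + t *\<^sub>R (y - z)))"
    by (rule ext) (simp add: \<psi>_def bregman_def blinfun.add_right blinfun.diff_right
        blinfun.scaleR_right algebra_simps)
  ultimately have "((\<lambda>t. \<psi> (z + t *\<^sub>R (y - z))) has_real_derivative
      - blinfun_apply (d' z - d' x + l *\<^sub>R g) (y - z)) (at 0)"
    by simp
  from DERIV_pos_inc_right[OF this] neg
  obtain e where e: "e > 0" and inc: "\<And>t. 0 < t \<Longrightarrow> t < e \<Longrightarrow> \<psi> z < \<psi> (z + t *\<^sub>R (y - z))"
    by auto
  \<comment> \<open>The bound 1 keeps the point on the segment, hence in \<open>Q\<close>;
    \<open>e / 2\<close> keeps it where \<open>\<psi>\<close> exceeds its value at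
    \<open>z\<close>.\<close>
  define t where "t = min 1 (e / 2)"
  have t: "0 < t" "t \<le> 1" "t < e" using e by (auto simp: t_def)
  have "(1 - t) *\<^sub>R z + t *\<^sub>R y \<in> Q"
    using convexD_alt[OF \<open>convex Q\<close> z \<open>y \<in> Q\<close>] t by simp
  then have "z + t *\<^sub>R (y - z) \<in> Q" by (simp add: algebra_simps)
  with max inc[OF t(1,3)] show False by force
qed

lemma objective_gain_eq:
  assumes "is_objective_step Q d d' g x l z"
  shows "objective_gain Q d d' g x l = l * blinfun_apply g (x - z) - bregman d d' x z"
  unfolding objective_gain_def using assms
  by (intro cSup_eq_maximum) (auto simp: is_objective_step_def is_arg_max_def not_less)

text \<open>Splitting \<open>y - z\<close> at \<open>x\<close> separates a part controlled by the
  subgradient inequality from one that, together with \<open>- bregman d d' x z\<close>, is exactly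
  the gain.\<close>

lemma objective_step_descent:
  assumes "is_objective_step Q d d' g x l z" and "l \<ge> 0"
    and "prox_function Q S d d'" and "convex Q"
    and "is_subgradient Q F x g" and "y \<in> Q"
  shows "bregman d d' z y \<le> bregman d d' x y + objective_gain Q d d' g x l - l * (F x - F y)"
proof -
  have "l * blinfun_apply g (y - x) \<le> l * (F y - F x)"
    using assms(2,5,6) by (intro mult_left_mono) (auto simp: is_subgradient_def)
  moreover have "l * blinfun_apply g (y - z) = l * blinfun_apply g (y - x) + l * blinfun_apply g (x - z)"
    by (simp add: blinfun.diff_right algebra_simps)
  ultimately show ?thesis
    using bregman_step_le[OF objective_step_optimality[OF assms(1,3,4,6)], of d]
      objective_gain_eq[OF assms(1)]
    by (simp add: algebra_simps)
qed

text \<open>With \<open>r = norm (z - x)\<close>, strong convexity bounds the gain by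
  \<open>l * norm g * r - r\<^sup>2 / 2\<close>; completing the square gives the claim.\<close>

lemma objective_gain_le:
  assumes "is_objective_step Q d d' g x l z" and "l \<ge> 0"
    and "prox_function Q S d d'" and "x \<in> Q"
  shows "objective_gain Q d d' g x l \<le> (l * norm g)\<^sup>2 / 2"
proof -
  have "z \<in> Q" using assms(1) by (simp add: is_objective_step_def is_arg_max_def)
  have "blinfun_apply g (x - z) \<le> norm g * norm (z - x)"
    using norm_blinfun[of g "x - z"] by (simp add: norm_minus_commute)
  then have "l * blinfun_apply g (x - z) \<le> l * (norm g * norm (z - x))"
    using assms(2) by (rule mult_left_mono)
  moreover have "0 \<le> (l * norm g - norm (z - x))\<^sup>2" by simp
  ultimately show ?thesis
    using bregman_ge_half_norm_sq[OF assms(3,4) \<open>z \<in> Q\<close>] objective_gain_eq[OF assms(1)]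
    by (simp add: power2_eq_square algebra_simps)
qed

text \<open>A short constraint step certifies a small violation: the linearization is nonpositive at
  \<open>z\<close>, and \<open>z\<close> lies within distance \<open>h\<close> of
  \<open>x\<close>.\<close>

lemma constraint_step_value_le:
  assumes "is_constraint_step Q d d' c g x z" and "prox_function Q S d d'" and "x \<in> Q"
    and "bregman d d' x z \<le> h\<^sup>2 / 2" and "h \<ge> 0"
  shows "c \<le> norm g * h"
proof -
  have z: "z \<in> Q" and c: "c + blinfun_apply g (z - x) \<le> 0"
    using assms(1) by (auto simp: is_constraint_step_def is_arg_min_def)
  have "(norm (z - x))\<^sup>2 \<le> h\<^sup>2"
    using bregman_ge_half_norm_sq[OF assms(2,3) z] assms(4) by simp
  then have "norm (z - x) \<le> h" using assms(5) by (rule power2_le_imp_le)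
  then have "norm g * norm (z - x) \<le> norm g * h" by (rule mult_left_mono) simp
  moreover have "- blinfun_apply g (z - x) \<le> norm g * norm (z - x)"
    using norm_blinfun[of g "z - x"] by simp
  ultimately show ?thesis using c by linarith
qed

section \<open>Divergence delay, starting index and the sets of steps\<close>

lemma divergence_delay_sum_ge:
  assumes "filterlim (\<lambda>n. \<Sum>k<n. (\<tau> k)\<^sup>2) at_top sequentially"
  shows "(\<Sum>i=k..k + divergence_delay \<tau> k. (\<tau> i)\<^sup>2) \<ge> 1"
proof -
  \<comment> \<open>Divergence provides a witness for the \<open>LEAST\<close>. Requiring
    \<open>n \<ge> Suc k\<close> makes \<open>n - Suc k\<close> an untruncated difference, usable as
    a delay.\<close>
  have "eventually (\<lambda>n. (\<Sum>i<n. (\<tau> i)\<^sup>2) \<ge> (\<Sum>i<k. (\<tau> i)\<^sup>2) + 1 \<and> n \<ge> Suc k) sequentially"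
    using assms eventually_ge_at_top by (intro eventually_conj) (auto simp: filterlim_at_top)
  then obtain n where n: "(\<Sum>i<n. (\<tau> i)\<^sup>2) \<ge> (\<Sum>i<k. (\<tau> i)\<^sup>2) + 1" "n \<ge> Suc k"
    by (auto simp: eventually_sequentially)
  have "{..<n} = {..<k} \<union> {k..k + (n - Suc k)}" using n(2) by auto
  then have "(\<Sum>i<n. (\<tau> i)\<^sup>2) = (\<Sum>i<k. (\<tau> i)\<^sup>2) + (\<Sum>i=k..k + (n - Suc k). (\<tau> i)\<^sup>2)"
    by (simp add: sum.union_disjoint disjoint_iff)
  then have "(\<Sum>i=k..k + (n - Suc k). (\<tau> i)\<^sup>2) \<ge> 1" using n(1) by linarith
  then show ?thesis unfolding divergence_delay_def by (rule LeastI)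
qed

text \<open>The set under \<open>Max\<close> is finite, and the bound on \<open>N\<close> puts 0
  into it, so its maximum is a member.\<close>

lemma start_index_delay_le:
  assumes "N \<ge> 1 + divergence_delay \<tau> 0"
  shows "start_index \<tau> N + divergence_delay \<tau> (start_index \<tau> N) \<le> N - 1"
proof -
  have "finite {k. k + divergence_delay \<tau> k \<le> N - 1}"
    by (rule finite_subset[of _ "{..N - 1}"]) auto
  then have "Max {k. k + divergence_delay \<tau> k \<le> N - 1} \<in> {k. k + divergence_delay \<tau> k \<le> N - 1}"
    using assms by (intro Max_in) (auto intro!: exI[of _ 0])
  then show ?thesis by (simp add: start_index_def)
qed

text \<open>The window that the delay attaches to the starting index ends by \<open>N - 1\<close>,
  so it fits into the summation range.\<close>

lemma start_index_sum_ge: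
  assumes "filterlim (\<lambda>n. \<Sum>k<n. (\<tau> k)\<^sup>2) at_top sequentially"
    and "N \<ge> 1 + divergence_delay \<tau> 0"
  shows "(\<Sum>k=start_index \<tau> N..<N. (\<tau> k)\<^sup>2) \<ge> 1"
proof -
  let ?s = "start_index \<tau> N"
  have "(\<Sum>i=?s..?s + divergence_delay \<tau> ?s. (\<tau> i)\<^sup>2) \<le> (\<Sum>k=?s..<N. (\<tau> k)\<^sup>2)"
    using start_index_delay_le[OF assms(2)] assms(2) by (intro sum_mono2) auto
  with divergence_delay_sum_ge[OF assms(1), of ?s] show ?thesis by linarith
qed

text \<open>The condition \<open>N \<ge> 1\<close> guards against truncated subtraction: for
  \<open>N = 0\<close> the bound \<open>k \<le> N - 1\<close> would still allow
  \<open>k = 0\<close>.\<close>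

lemma steps_with_eq:
  assumes "N \<ge> 1"
  shows "steps_with \<tau> j i N = {k \<in> {start_index \<tau> N..<N}. j k = i}"
  using assms by (auto simp: steps_with_def)

text \<open>Grouping the iterations by the chosen constraint turns a sum over time into the
  constraint part of a Lagrangian.\<close>

lemma sum_constraint_steps:
  assumes "N \<ge> 1" and "\<And>k. j k \<le> m"
  shows "(\<Sum>k | k \<in> {start_index \<tau> N..<N} \<and> j k \<noteq> 0. l k * c (j k))
    = (\<Sum>i=1..m. multiplier_sum \<tau> j l i N * c i)"
proof -
  let ?C = "{k. k \<in> {start_index \<tau> N..<N} \<and> j k \<noteq> 0}"
  have "(\<Sum>k\<in>?C. l k * c (j k)) = (\<Sum>i=1..m. \<Sum>k | k \<in> ?C \<and> j k = i. l k * c (j k))"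
    using assms(2) by (intro sum.group[symmetric]) (auto simp: Suc_le_eq)
  also have "\<dots> = (\<Sum>i=1..m. multiplier_sum \<tau> j l i N * c i)"
    unfolding multiplier_sum_def sum_distrib_right steps_with_eq[OF assms(1)]
    by (intro sum.cong refl) auto
  finally show ?thesis .
qed

section \<open>Consequences of the run, iteration by iteration and summed\<close>

lemma switching_run_in_Q:
  assumes "switching_run Q m f f' d d' h x T j l"
  shows "x k \<in> Q"
proof (cases k)
  case 0
  then show ?thesis using assms by (simp add: switching_run_def)
next
  case (Suc n)
  have "is_constraint_step Q d d' (f i (x n)) (f' i (x n)) (x n) (T n i)" if "i \<in> {1..m}" for i
    using assms that unfolding switching_run_def by blast
  then have "T n i \<in> Q" if "i \<in> {1..m}" for i
    using that by (auto simp: is_constraint_step_def is_arg_min_def)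
  moreover have "(j n \<in> {1..m} \<and> x (Suc n) = T n (j n)) \<or>
      is_objective_step Q d d' (f' 0 (x n)) (x n) (l n) (x (Suc n))"
    using assms unfolding switching_run_def by meson
  ultimately show ?thesis
    using Suc by (auto simp: is_objective_step_def is_arg_max_def)
qed

lemma switching_run_objective:
  assumes "switching_run Q m f f' d d' h x T j l" and "j k = 0"
  shows "l k > 0" "objective_gain Q d d' (f' 0 (x k)) (x k) (l k) = (h k)\<^sup>2 / 2"
    "is_objective_step Q d d' (f' 0 (x k)) (x k) (l k) (x (Suc k))"
    "i \<in> {1..m} \<Longrightarrow> is_constraint_step Q d d' (f i (x k)) (f' i (x k)) (x k) (T k i)"
    "i \<in> {1..m} \<Longrightarrow> bregman d d' (x k) (T k i) < (h k)\<^sup>2 / 2"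
proof -
  have run: "\<forall>i\<in>{1..m}. is_constraint_step Q d d' (f i (x k)) (f' i (x k)) (x k) (T k i)"
    "if \<exists>i\<in>{1..m}. bregman d d' (x k) (T k i) \<ge> (1/2) * (h k)\<^sup>2
        then j k \<in> {1..m} \<and>
             bregman d d' (x k) (T k (j k)) \<ge> (1/2) * (h k)\<^sup>2 \<and>
             is_constraint_multiplier Q d' (f (j k) (x k)) (f' (j k) (x k)) (x k) (T k (j k)) (l k) \<and>
             x (Suc k) = T k (j k)
        else j k = 0 \<and>
             l k > 0 \<and>
             objective_gain Q d d' (f' 0 (x k)) (x k) (l k) = (1/2) * (h k)\<^sup>2 \<and>
             is_objective_step Q d d' (f' 0 (x k)) (x k) (l k) (x (Suc k))"
    using assms(1) unfolding switching_run_def by blast+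
  \<comment> \<open>The constraint branch would put \<open>j k\<close> into \<open>{1..m}\<close>,
    which excludes 0.\<close>
  have no: "\<not> (\<exists>i\<in>{1..m}. bregman d d' (x k) (T k i) \<ge> (1/2) * (h k)\<^sup>2)"
    using run(2) assms(2) by (auto split: if_splits)
  show "l k > 0" "objective_gain Q d d' (f' 0 (x k)) (x k) (l k) = (h k)\<^sup>2 / 2"
    "is_objective_step Q d d' (f' 0 (x k)) (x k) (l k) (x (Suc k))"
    using run(2) unfolding if_not_P[OF no] by auto
  show "i \<in> {1..m} \<Longrightarrow> is_constraint_step Q d d' (f i (x k)) (f' i (x k)) (x k) (T k i)"
    using run(1) by blast
  show "i \<in> {1..m} \<Longrightarrow> bregman d d' (x k) (T k i) < (h k)\<^sup>2 / 2"
    using no by (auto simp: not_le)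
qed

lemma switching_run_constraint:
  assumes "switching_run Q m f f' d d' h x T j l" and "j k \<noteq> 0"
  shows "j k \<in> {1..m}" "bregman d d' (x k) (x (Suc k)) \<ge> (h k)\<^sup>2 / 2"
    "is_constraint_multiplier Q d' (f (j k) (x k)) (f' (j k) (x k)) (x k) (x (Suc k)) (l k)"
proof -
  have "j k \<in> {1..m} \<and> bregman d d' (x k) (T k (j k)) \<ge> (1/2) * (h k)\<^sup>2 \<and>
      is_constraint_multiplier Q d' (f (j k) (x k)) (f' (j k) (x k)) (x k) (T k (j k)) (l k) \<and>
      x (Suc k) = T k (j k)"
    using assms unfolding switching_run_def by meson
  then show "j k \<in> {1..m}" "bregman d d' (x k) (x (Suc k)) \<ge> (h k)\<^sup>2 / 2"
    "is_constraint_multiplier Q d' (f (j k) (x k)) (f' (j k) (x k)) (x k) (x (Suc k)) (l k)"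
    by auto
qed

text \<open>The one-step estimates telescope from \<open>s\<close> to \<open>N\<close>; the final
  potential is nonnegative and is dropped.\<close>

lemma switching_run_potential_sum:
  assumes run: "switching_run Q m f f' d d' h x T j l"
    and prox: "prox_function Q S d d'" and "convex Q"
    and sub: "\<forall>i\<le>m. \<forall>y\<in>Q. is_subgradient Q (f i) y (f' i y)"
    and y: "y \<in> Q" and "s \<le> N"
  shows "(\<Sum>k | k \<in> {s..<N} \<and> j k = 0. l k * (f 0 (x k) - f 0 y))
    \<le> bregman d d' (x s) y + (\<Sum>k | k \<in> {s..<N} \<and> j k = 0. (h k)\<^sup>2 / 2)
      + (\<Sum>k | k \<in> {s..<N} \<and> j k \<noteq> 0. l k * f (j k) y - (h k)\<^sup>2 / 2)"
proof -
  define B where "B k = bregman d d' (x k) y" for k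
  define u where "u k = (if j k = 0 then (h k)\<^sup>2 / 2 - l k * (f 0 (x k) - f 0 y)
    else l k * f (j k) y - (h k)\<^sup>2 / 2)" for k
  have xQ: "x k \<in> Q" for k using switching_run_in_Q[OF run] .
  have step: "B (Suc k) - B k \<le> u k" for k
  proof (cases "j k = 0")
    case True
    note o = switching_run_objective[OF run True]
    have "is_subgradient Q (f 0) (x k) (f' 0 (x k))" using sub xQ by blast
    from objective_step_descent[OF o(3) less_imp_le[OF o(1)] prox \<open>convex Q\<close> this y] o(2) True
    show ?thesis by (simp add: B_def u_def)
  next
    case False
    note c = switching_run_constraint[OF run False]
    have "is_subgradient Q (f (j k)) (x k) (f' (j k) (x k))" using sub xQ c(1) by auto
    from constraint_step_descent[OF c(3) this y, of d] c(2) False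
    show ?thesis by (simp add: B_def u_def)
  qed
  have "B N - B s = (\<Sum>k=s..<N. B (Suc k) - B k)"
    using \<open>s \<le> N\<close> by (simp add: sum_Suc_diff')
  also have "\<dots> \<le> (\<Sum>k=s..<N. u k)" by (intro sum_mono step)
  also have "\<dots> = (\<Sum>k | k \<in> {s..<N} \<and> j k = 0. (h k)\<^sup>2 / 2 - l k * (f 0 (x k) - f 0 y))
      + (\<Sum>k | k \<in> {s..<N} \<and> j k \<noteq> 0. l k * f (j k) y - (h k)\<^sup>2 / 2)"
    unfolding u_def by (subst sum.If_cases) (auto intro!: arg_cong2[where f="(+)"] sum.cong)
  finally have "B N - B s \<le> \<dots>" .
  moreover have "B N \<ge> 0"
    using order_trans[OF _ bregman_ge_half_norm_sq[OF prox xQ y], of 0] by (simp add: B_def)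
  ultimately show ?thesis by (simp add: B_def sum_subtractf)
qed

section \<open>Existence of objective steps, feasibility and the duality bound\<close>

theorem theorem4:
  fixes Q S :: "'a::real_normed_vector set"
    and f :: "nat \<Rightarrow> 'a \<Rightarrow> real"
    and f' :: "nat \<Rightarrow> 'a \<Rightarrow> 'a \<Rightarrow>\<^sub>L real"
    and d :: "'a \<Rightarrow> real"
    and d' :: "'a \<Rightarrow> 'a \<Rightarrow>\<^sub>L real"
    and D :: real
    and \<tau> h l :: "nat \<Rightarrow> real"
    and x :: "nat \<Rightarrow> 'a"
    and T :: "nat \<Rightarrow> nat \<Rightarrow> 'a"
    and j :: "nat \<Rightarrow> nat"
    and xopt :: 'a
    and m N :: nat
  assumes "finite_dimensional TYPE('a)"
    and "closed Q" and "convex Q" and "bounded Q"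
    and "\<forall>i\<le>m. closed_convex_on Q (f i)"
    and "\<forall>i\<le>m. \<forall>y\<in>Q. is_subgradient Q (f i) y (f' i y)"
    and "prox_function Q S d d'"
    and "\<forall>y\<in>Q. \<forall>z\<in>Q. bregman d d' y z < D"
    and "is_arg_min (f 0) (feasible Q m f) xopt"
    and "\<forall>k. \<tau> k \<ge> \<tau> (Suc k) \<and> \<tau> (Suc k) > 0"
    and "filterlim (\<lambda>n. \<Sum>k<n. (\<tau> k)\<^sup>2) at_top sequentially"
    and "\<forall>k. h k = sqrt (2 * D) * \<tau> k"
    and "switching_run Q m f f' d d' h x T j l"
    and "N \<ge> 1 + divergence_delay \<tau> 0"
  shows "steps_with \<tau> j 0 N \<noteq> {} \<and>
    (\<forall>M. (\<forall>i\<le>m. M i > 0 \<and> (\<forall>y\<in>Q. norm (f' i y) \<le> M i)) \<longrightarrow>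
       (\<forall>k\<in>steps_with \<tau> j 0 N.
          m \<ge> 1 \<longrightarrow> (MAX i\<in>{1..m}. (1 / M i) * f i (x k)) \<le> h (start_index \<tau> N)) \<and>
       (1 / multiplier_sum \<tau> j l 0 N) * (\<Sum>k\<in>steps_with \<tau> j 0 N. l k * f 0 (x k))
         \<le> dual_function Q m f (dual_estimate \<tau> j l N) + M 0 * h (start_index \<tau> N))"
proof -
  note convex = \<open>convex Q\<close> and sub = assms(6) and prox = assms(7) and run = assms(13)
  define s where "s = start_index \<tau> N"
  define A where "A = steps_with \<tau> j 0 N"
  define \<sigma> where "\<sigma> = multiplier_sum \<tau> j l 0 N"
  have N: "N \<ge> 1" using assms(14) by simp
  have s: "s \<le> N" using start_index_delay_le[OF assms(14)] by (simp add: s_def)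
  have A: "A = {k. k \<in> {s..<N} \<and> j k = 0}" using steps_with_eq[OF N] by (simp add: A_def s_def)
  have A_fin: "finite A" by (simp add: A)
  have xQ: "x k \<in> Q" for k using switching_run_in_Q[OF run] .
  \<comment> \<open>The Bregman distance from a point of \<open>Q\<close> to itself is 0, and
    \<open>D\<close> bounds it strictly.\<close>
  have D: "D > 0"
    using assms(8) xQ[of 0] by (force simp: bregman_def blinfun.zero_right)
  have h_pos: "h k > 0" for k using run by (simp add: switching_run_def)
  have "decseq \<tau>" using assms(10) by (simp add: decseq_Suc_iff)
  then have h_le: "h k \<le> h s" if "s \<le> k" for k
    using that assms(12) D by (simp add: decseqD)
  have "D * 1 \<le> D * (\<Sum>k=s..<N. (\<tau> k)\<^sup>2)"
    using start_index_sum_ge[OF assms(11,14)] D unfolding s_def by (intro mult_left_mono) auto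
  also have "\<dots> = (\<Sum>k=s..<N. (h k)\<^sup>2 / 2)"
    using assms(12) D by (simp add: sum_distrib_left power_mult_distrib)
  also have "\<dots> = (\<Sum>k\<in>A. (h k)\<^sup>2 / 2) + (\<Sum>k | k \<in> {s..<N} \<and> j k \<noteq> 0. (h k)\<^sup>2 / 2)"
    unfolding A by (subst sum.union_disjoint[symmetric]) (auto intro!: sum.cong)
  finally have energy: "D \<le> \<dots>" by simp
  \<comment> \<open>By \<open>energy\<close>, the decrease over the constraint steps is at least
    \<open>D\<close> minus the half squares over \<open>A\<close>. This doubles the error over
    \<open>A\<close>, and \<open>D\<close> absorbs the initial potential; the inequality is strict
    because that potential is below \<open>D\<close>.\<close>
  have aggregate: "(\<Sum>k\<in>A. l k * (f 0 (x k) - f 0 y))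
      < (\<Sum>k\<in>A. (h k)\<^sup>2) + (\<Sum>i=1..m. multiplier_sum \<tau> j l i N * f i y)" if y: "y \<in> Q" for y
  proof -
    have "(\<Sum>k | k \<in> {s..<N} \<and> j k \<noteq> 0. l k * f (j k) y)
        = (\<Sum>i=1..m. multiplier_sum \<tau> j l i N * f i y)"
      unfolding s_def
    proof (rule sum_constraint_steps[OF N])
      show "j k \<le> m" for k
        using switching_run_constraint(1)[OF run, of k] by (cases "j k = 0") auto
    qed
    moreover have "bregman d d' (x s) y < D" using assms(8) xQ y by blast
    moreover have "(\<Sum>k\<in>A. (h k)\<^sup>2) = (\<Sum>k\<in>A. (h k)\<^sup>2 / 2) + (\<Sum>k\<in>A. (h k)\<^sup>2 / 2)"
      by (simp flip: sum.distrib)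
    ultimately show ?thesis
      using switching_run_potential_sum[OF run prox convex sub y s] energy
      unfolding A[symmetric] sum_subtractf by linarith
  qed
  have A_ne: "A \<noteq> {}"
  proof
    assume "A = {}"
    have opt: "xopt \<in> Q" "\<And>i. i \<in> {1..m} \<Longrightarrow> f i xopt \<le> 0"
      using assms(9) by (auto simp: is_arg_min_def feasible_def)
    have "multiplier_sum \<tau> j l i N \<ge> 0" if "i \<in> {1..m}" for i
      unfolding multiplier_sum_def
    proof (rule sum_nonneg)
      fix k assume "k \<in> steps_with \<tau> j i N"
      then have "j k \<noteq> 0" using that by (simp add: steps_with_def)
      then show "l k \<ge> 0"
        using switching_run_constraint(3)[OF run] by (simp add: is_constraint_multiplier_def)
    qed
    then have "(\<Sum>i=1..m. multiplier_sum \<tau> j l i N * f i xopt) \<le> 0"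
      using opt(2) by (intro sum_nonpos mult_nonneg_nonpos) auto
    \<comment> \<open>Both sums over \<open>A\<close> are empty, so at the feasible point
      \<open>xopt\<close> the strict inequality says that a nonpositive number is positive.\<close>
    with aggregate[OF opt(1)] show False by (simp add: \<open>A = {}\<close>)
  qed
  have l_pos: "l k > 0" if "k \<in> A" for k
    using that switching_run_objective(1)[OF run] by (simp add: A)
  have \<sigma>_pos: "\<sigma> > 0"
    unfolding \<sigma>_def multiplier_sum_def A_def[symmetric] by (rule sum_pos[OF A_fin A_ne l_pos])
  have feasibility: "(MAX i\<in>{1..m}. (1 / M i) * f i (x k)) \<le> h s"
    if M: "\<forall>i\<le>m. M i > 0 \<and> (\<forall>y\<in>Q. norm (f' i y) \<le> M i)" and k: "k \<in> A" and m: "m \<ge> 1"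
    for M :: "nat \<Rightarrow> real" and k
  proof -
    have "(1 / M i) * f i (x k) \<le> h s" if i: "i \<in> {1..m}" for i
    proof -
      have jk: "j k = 0" and sk: "s \<le> k" using k by (auto simp: A)
      \<comment> \<open>An objective step is taken only when every constraint step is shorter than
        the threshold, so the violation bound applies to each \<open>i\<close>.\<close>
      have "f i (x k) \<le> norm (f' i (x k)) * h k"
        using switching_run_objective(4,5)[OF run jk i] h_pos[of k]
        by (intro constraint_step_value_le[OF _ prox xQ]) auto
      also have "\<dots> \<le> M i * h s"
        using M i xQ h_pos[of k] h_le[OF sk] by (intro mult_mono) (auto intro: less_imp_le)
      finally show ?thesis using M i by (simp add: field_simps)
    qed
    then show ?thesis using m by (subst Max_le_iff) auto
  qed
  have duality: "(1 / \<sigma>) * (\<Sum>k\<in>A. l k * f 0 (x k))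
      \<le> dual_function Q m f (dual_estimate \<tau> j l N) + M 0 * h s"
    if M: "\<forall>i\<le>m. M i > 0 \<and> (\<forall>y\<in>Q. norm (f' i y) \<le> M i)" for M :: "nat \<Rightarrow> real"
  proof -
    have "(h k)\<^sup>2 \<le> l k * (M 0 * h s)" if k: "k \<in> A" for k
    proof -
      have jk: "j k = 0" and sk: "s \<le> k" using k by (auto simp: A)
      note o = switching_run_objective[OF run jk]
      have "(h k)\<^sup>2 \<le> (l k * norm (f' 0 (x k)))\<^sup>2"
        using objective_gain_le[OF o(3) less_imp_le[OF o(1)] prox xQ] o(2) by simp
      then have "h k \<le> l k * norm (f' 0 (x k))"
        by (rule power2_le_imp_le) (use o(1) in simp)
      also have "\<dots> \<le> l k * M 0"
        using M xQ o(1) by (intro mult_left_mono) auto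
      \<comment> \<open>One factor \<open>h k\<close> is bounded through the gain, the other by
        monotonicity of the step bounds.\<close>
      finally have "h k * h k \<le> (l k * M 0) * h s"
        using h_le[OF sk] h_pos[of k] by (intro mult_mono) auto
      then show ?thesis by (simp add: power2_eq_square mult.assoc)
    qed
    then have "(\<Sum>k\<in>A. (h k)\<^sup>2) \<le> (\<Sum>k\<in>A. l k * (M 0 * h s))" by (rule sum_mono)
    then have err: "(\<Sum>k\<in>A. (h k)\<^sup>2) \<le> \<sigma> * (M 0 * h s)"
      by (simp add: \<sigma>_def multiplier_sum_def A_def sum_distrib_right)
    \<comment> \<open>Dividing by \<open>\<sigma>\<close> turns the multiplier sums into the dual
      estimate. The left side is independent of \<open>y\<close>, so it bounds the infimum over
      \<open>Q\<close> from below.\<close>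
    have "(1 / \<sigma>) * (\<Sum>k\<in>A. l k * f 0 (x k)) - M 0 * h s
        \<le> f 0 y + (\<Sum>i=1..m. dual_estimate \<tau> j l N i * f i y)" if y: "y \<in> Q" for y
    proof -
      have "(\<Sum>k\<in>A. l k * (f 0 (x k) - f 0 y)) = (\<Sum>k\<in>A. l k * f 0 (x k)) - \<sigma> * f 0 y"
        by (simp add: \<sigma>_def multiplier_sum_def A_def right_diff_distrib sum_subtractf sum_distrib_right)
      moreover have "(\<Sum>i=1..m. multiplier_sum \<tau> j l i N * f i y)
          = \<sigma> * (\<Sum>i=1..m. dual_estimate \<tau> j l N i * f i y)"
        using \<sigma>_pos by (simp add: dual_estimate_def sum_distrib_left flip: \<sigma>_def)
      ultimately have "(\<Sum>k\<in>A. l k * f 0 (x k))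
          \<le> \<sigma> * (f 0 y + (\<Sum>i=1..m. dual_estimate \<tau> j l N i * f i y) + M 0 * h s)"
        using aggregate[OF y] err by (simp add: distrib_left)
      then show ?thesis using \<sigma>_pos by (simp add: field_simps)
    qed
    then have "(1 / \<sigma>) * (\<Sum>k\<in>A. l k * f 0 (x k)) - M 0 * h s
        \<le> dual_function Q m f (dual_estimate \<tau> j l N)"
      unfolding dual_function_def using xQ by (intro cINF_greatest) auto
    then show ?thesis by simp
  qed
  show ?thesis
    using A_ne feasibility duality unfolding A_def s_def \<sigma>_def by blast
qed

end
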